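(* Let $m\ge n\ge 3$ be integers. Then ${\rm rn}(K_{1,m}\Box K_{1,n})=mn+3(m+n)+1$.
   Context: $K_{1,n}$ is the star with one center adjacent to $n$ leaves; $\Box$ denotes the Cartesian product of graphs. A radio labeling of a connected graph $G$ is a map $f:V(G)\to\mathbb{Z}_{\ge 0}$ with $|f(u)-f(v)|\geq {\rm diam}(G)+1-d(u,v)$ for all distinct vertices $u,v$, where $d$ is the graph distance; its span is $\max f-\min f$, and the radio number ${\rm rn}(G)$ is the minimum span of a radio labeling of $G$. *)

theory Defs
  imports "Graph_Theory.Graph_Theory"
begin

text \<open>
  A finite simple graph is a \<^term>\<open>pair_graph\<close>: every edge is represented by its two
  opposite arcs.
\<close>

definition star :: "nat \<Rightarrow> nat pair_pre_digraph" where
  "star n = \<lparr> pverts = {0..n}, parcs = {0} \<times> {1..n} \<union> {1..n} \<times> {0} \<rparr>"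

definition cartesian_product ::
    "'a pair_pre_digraph \<Rightarrow> 'b pair_pre_digraph \<Rightarrow> ('a \<times> 'b) pair_pre_digraph"
    (infixr "\<box>" 70) where
  "G \<box> H = \<lparr> pverts = pverts G \<times> pverts H,
     parcs = {((u, x), (v, y)) | u x v y.
       (u = v \<and> u \<in> pverts G \<and> (x, y) \<in> parcs H) \<or>
       (x = y \<and> x \<in> pverts H \<and> (u, v) \<in> parcs G)} \<rparr>"

text \<open>
  The remaining notions are meant for finite connected graphs only; elsewhere \<open>LEAST\<close> and
  \<open>Max\<close> may return unspecified values.
\<close>

definition graph_dist :: "'a pair_pre_digraph \<Rightarrow> 'a \<Rightarrow> 'a \<Rightarrow> nat" where
  "graph_dist G u v = (LEAST k. \<exists>p. pre_digraph.awalk (with_proj G) u p v \<and> length p = k)"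

definition diam :: "'a pair_pre_digraph \<Rightarrow> nat" where
  "diam G = Max {graph_dist G u v | u v. u \<in> pverts G \<and> v \<in> pverts G}"

definition radio_labeling :: "'a pair_pre_digraph \<Rightarrow> ('a \<Rightarrow> nat) \<Rightarrow> bool" where
  "radio_labeling G f \<longleftrightarrow>
     (\<forall>u \<in> pverts G. \<forall>v \<in> pverts G. u \<noteq> v \<longrightarrow>
        \<bar>int (f u) - int (f v)\<bar> \<ge> int (diam G) + 1 - int (graph_dist G u v))"

definition label_span :: "'a pair_pre_digraph \<Rightarrow> ('a \<Rightarrow> nat) \<Rightarrow> nat" where
  "label_span G f = Max (f ` pverts G) - Min (f ` pverts G)"

definition radio_number :: "'a pair_pre_digraph \<Rightarrow> nat" where
  "radio_number G = (LEAST k. \<exists>f. radio_labeling G f \<and> label_span G f = k)"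

lemma star_complete_bipartite: "K\<^bsub>1,n\<^esub> (with_proj (star n))"
  unfolding complete_bipartite_digraph_pair_def
proof (intro conjI exI)
  show "pverts (star n) = {0} \<union> {1..n}" "parcs (star n) = {0} \<times> {1..n} \<union> {1..n} \<times> {0}"
    by (auto simp: star_def)
qed (auto simp: star_def)

lemma pair_graph_cartesian_product:
  assumes "pair_graph G" "pair_graph H"
  shows "pair_graph (G \<box> H)"
proof -
  interpret G: pair_graph G by fact
  interpret H: pair_graph H by fact
  have wf: "e \<in> parcs (G \<box> H) \<Longrightarrow> fst e \<in> pverts (G \<box> H) \<and> snd e \<in> pverts (G \<box> H)" for e
    by (auto simp: cartesian_product_def dest: G.wellformed' H.wellformed')
  have fin: "finite (pverts (G \<box> H))"
    by (simp add: cartesian_product_def G.pair_finite_verts H.pair_finite_verts)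
  have "parcs (G \<box> H) \<subseteq> pverts (G \<box> H) \<times> pverts (G \<box> H)"
    using wf by (metis mem_Times_iff subsetI)
  then have fin': "finite (parcs (G \<box> H))"
    using fin by (blast intro: finite_subset[OF _ finite_cartesian_product])
  have sym: "symmetric (with_proj (G \<box> H))"
    using G.pair_sym_arcs H.pair_sym_arcs
    by (auto simp: symmetric_def cartesian_product_def sym_def)
  have loop: "fst e \<noteq> snd e" if "e \<in> parcs (G \<box> H)" for e
    using that by (auto simp: cartesian_product_def dest: G.pair_no_loops H.pair_no_loops)
  show ?thesis
    by unfold_locales (use wf fin fin' sym loop in auto)
qed

lemma connected_star_product: "connected (with_proj (star m \<box> star n))"
proof -
  let ?G = "star m \<box> star n"
  have pg: "pair_graph (star k)" for k
    using star_complete_bipartite by (rule pair_graphI_complete_bipartite)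
  interpret pair_graph ?G
    by (intro pair_graph_cartesian_product pg)
  have adj: "u \<rightarrow>\<^sup>*\<^bsub>with_proj ?G\<^esub> v" if "(u, v) \<in> parcs ?G" for u v
    using that reachable_adjI by simp
  have rf: "(a, b) \<rightarrow>\<^sup>*\<^bsub>with_proj ?G\<^esub> (a, b)" if "a \<le> m" "b \<le> n" for a b
    by (rule reachable_refl) (use that in \<open>simp add: cartesian_product_def star_def\<close>)
  have *: "(a, b) \<rightarrow>\<^sup>*\<^bsub>with_proj ?G\<^esub> (0, 0) \<and> (0, 0) \<rightarrow>\<^sup>*\<^bsub>with_proj ?G\<^esub> (a, b)"
    if ab: "a \<le> m" "b \<le> n" for a b
  proof -
    have "(a, b) \<rightarrow>\<^sup>*\<^bsub>with_proj ?G\<^esub> (0, b) \<and> (0, b) \<rightarrow>\<^sup>*\<^bsub>with_proj ?G\<^esub> (a, b)"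
    proof (cases "a = 0")
      case True
      then show ?thesis using rf[OF ab] rf[of 0 b] rf[of 0 0] ab by simp
    next
      case False
      then show ?thesis using ab by (intro conjI adj) (auto simp: cartesian_product_def star_def)
    qed
    moreover have "(0, b) \<rightarrow>\<^sup>*\<^bsub>with_proj ?G\<^esub> (0, 0) \<and> (0, 0) \<rightarrow>\<^sup>*\<^bsub>with_proj ?G\<^esub> (0, b)"
    proof (cases "b = 0")
      case True
      then show ?thesis using rf[OF ab] rf[of 0 b] rf[of 0 0] ab by simp
    next
      case False
      then show ?thesis using ab by (intro conjI adj) (auto simp: cartesian_product_def star_def)
    qed
    ultimately show ?thesis using reachable_trans by blast
  qed
  have "u \<rightarrow>\<^sup>*\<^bsub>with_proj ?G\<^esub> v" if "u \<in> pverts ?G" "v \<in> pverts ?G" for u v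
  proof -
    have "u \<rightarrow>\<^sup>*\<^bsub>with_proj ?G\<^esub> (0, 0)" "(0, 0) \<rightarrow>\<^sup>*\<^bsub>with_proj ?G\<^esub> v"
      using that * by (auto simp: cartesian_product_def star_def)
    then show ?thesis by (rule reachable_trans)
  qed
  then have "strongly_connected (with_proj ?G)"
    by (intro strongly_connectedI) (auto simp: cartesian_product_def star_def)
  then show ?thesis
    using reachable_mk_symmetric_eq[OF sym_arcs]
    by (simp add: connected_def strongly_connected_def)
qed

end

theory Submission
  imports Defs
begin

text \<open>
  Let the weight of a vertex be its distance to the centre \<open>(0, 0)\<close>. Listing the vertices
  by increasing label, consecutive labels differ by at least 5 minus the two weights; summing up,
  every weight is counted twice except those of the two extreme vertices, which are distinct and
  hence not both the centre. This gives the lower bound.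

  An optimal labeling visits the centre, then alternately the cyclic diagonals
  \<open>{((s + j) mod m, j) | j < n}\<close> of leaf pairs and the vertices \<open>(s, -)\<close>
  (rows and columns counted from 0), and finally the vertices \<open>(-, j)\<close>. Any three
  successive leaf pairs or row vertices then share no row and no column.
\<close>

section \<open>Distances and diameter in the product of two stars\<close>

definition star_dist :: "nat \<Rightarrow> nat \<Rightarrow> nat" where
  "star_dist a b = (if a = b then 0 else if a = 0 \<or> b = 0 then 1 else 2)"

definition star_walk :: "nat \<Rightarrow> nat \<Rightarrow> (nat \<times> nat) list" where
  "star_walk a b = (if a = b then [] else if a = 0 \<or> b = 0 then [(a, b)] else [(a, 0), (0, b)])"

lemma length_star_walk: "length (star_walk a b) = star_dist a b"
  by (simp add: star_walk_def star_dist_def)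

text \<open>Upper half of the distance formula: move in the first coordinate with \<open>b\<close>
  fixed, then in the second with \<open>a'\<close> fixed, passing through the centre of a star
  between two of its leaves.\<close>

lemma awalk_star_product:
  assumes "a \<le> m" "a' \<le> m" "b \<le> n" "b' \<le> n"
  shows "pre_digraph.awalk (with_proj (star m \<box> star n)) (a, b)
    (map (\<lambda>(x, y). ((x, b), (y, b))) (star_walk a a') @
     map (\<lambda>(x, y). ((a', x), (a', y))) (star_walk b b')) (a', b')"
  using assms
  by (auto simp: pre_digraph.awalk_def pre_digraph.cas.simps star_walk_def
      cartesian_product_def star_def)

text \<open>Lower half of the distance formula: an arc moves one coordinate by one star edge, so by
  the triangle inequality in each star it shortens the remaining distance by at most 1. As
  \<open>cas\<close> only checks that arcs chain up, their membership in the graph is a separate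
  hypothesis.\<close>

lemma cas_star_product_length:
  assumes "pre_digraph.cas (with_proj (star m \<box> star n)) u p v"
    and "set p \<subseteq> parcs (star m \<box> star n)"
  shows "star_dist (fst u) (fst v) + star_dist (snd u) (snd v) \<le> length p"
  using assms
proof (induction p arbitrary: u)
  case Nil
  then show ?case by (simp add: pre_digraph.cas.simps star_dist_def)
next
  case (Cons e p)
  obtain z where e: "e = (u, z)" and "pre_digraph.cas (with_proj (star m \<box> star n)) z p v"
    using Cons.prems(1) by (cases e) (auto simp: pre_digraph.cas.simps)
  then have IH: "star_dist (fst z) (fst v) + star_dist (snd z) (snd v) \<le> length p"
    using Cons by simp
  have "star_dist (fst u) (fst z) + star_dist (snd u) (snd z) \<le> 1"
    using Cons.prems(2) e by (auto simp: cartesian_product_def star_def star_dist_def)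
  moreover have "star_dist x w \<le> star_dist x y + star_dist y w" for x y w
    by (simp add: star_dist_def)
  from this[of "fst u" "fst v" "fst z"] this[of "snd u" "snd v" "snd z"]
  have "star_dist (fst u) (fst v) + star_dist (snd u) (snd v) \<le>
    (star_dist (fst u) (fst z) + star_dist (snd u) (snd z)) +
    (star_dist (fst z) (fst v) + star_dist (snd z) (snd v))"
    by linarith
  ultimately show ?case using IH by simp
qed

lemma graph_dist_star_product:
  assumes "a \<le> m" "a' \<le> m" "b \<le> n" "b' \<le> n"
  shows "graph_dist (star m \<box> star n) (a, b) (a', b') = star_dist a a' + star_dist b b'"
  unfolding graph_dist_def
proof (rule Least_equality)
  show "\<exists>p. pre_digraph.awalk (with_proj (star m \<box> star n)) (a, b) p (a', b') \<and>
      length p = star_dist a a' + star_dist b b'"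
    using awalk_star_product[OF assms] by (intro exI conjI) (auto simp: length_star_walk)
next
  fix k
  assume "\<exists>p. pre_digraph.awalk (with_proj (star m \<box> star n)) (a, b) p (a', b') \<and> length p = k"
  then show "star_dist a a' + star_dist b b' \<le> k"
    using cas_star_product_length by (fastforce simp: pre_digraph.awalk_def)
qed

lemma pverts_star_product: "pverts (star m \<box> star n) = {0..m} \<times> {0..n}"
  by (simp add: cartesian_product_def star_def)

lemma diam_star_product:
  assumes "m \<ge> 2" "n \<ge> 2"
  shows "diam (star m \<box> star n) = 4"
proof -
  let ?D = "{graph_dist (star m \<box> star n) u v | u v.
    u \<in> pverts (star m \<box> star n) \<and> v \<in> pverts (star m \<box> star n)}"
  have le: "d \<le> 4" if "d \<in> ?D" for d
    using that by (auto simp: pverts_star_product graph_dist_star_product star_dist_def)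
  \<comment> \<open>Leaf pairs differing in both coordinates are farthest apart; two leaves in each
    star provide them.\<close>
  have "graph_dist (star m \<box> star n) (1, 1) (2, 2) = 4"
    using assms by (simp add: graph_dist_star_product star_dist_def)
  moreover have "(1, 1) \<in> pverts (star m \<box> star n)" "(2, 2) \<in> pverts (star m \<box> star n)"
    using assms by (auto simp: pverts_star_product)
  ultimately have "4 \<in> ?D" by force
  moreover have "finite ?D" using le by (meson atMost_iff finite_atMost finite_subset subsetI)
  ultimately show ?thesis
    unfolding diam_def using le by (intro Max_eqI)
qed

text \<open>The 5 is the diameter plus 1; through this form both bounds become pure arithmetic on
  coordinates.\<close>

lemma radio_labeling_star_product_iff:
  assumes "m \<ge> 2" "n \<ge> 2"
  shows "radio_labeling (star m \<box> star n) f \<longleftrightarrow>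
    (\<forall>a \<le> m. \<forall>b \<le> n. \<forall>a' \<le> m. \<forall>b' \<le> n. (a, b) \<noteq> (a', b') \<longrightarrow>
      5 - int (star_dist a a' + star_dist b b') \<le> \<bar>int (f (a, b)) - int (f (a', b'))\<bar>)"
  unfolding radio_labeling_def diam_star_product[OF assms] pverts_star_product
  by (auto simp: graph_dist_star_product)

section \<open>Lower bound on the span\<close>

text \<open>Elements are inserted in order of increasing \<open>f\<close>. The maximality of
  \<open>x\<close> is carried along so that the next element can be compared with the current top:
  the new gap is at least \<open>K\<close> minus both weights, after which the old top is an
  interior element and its weight is counted twice.\<close>

lemma weighted_gap_bound:
  fixes f w :: "'a \<Rightarrow> int" and K :: int
  assumes "finite A" "A \<noteq> {}"
    and "\<And>u v. u \<in> A \<Longrightarrow> v \<in> A \<Longrightarrow> u \<noteq> v \<Longrightarrow> K - w u - w v \<le> \<bar>f u - f v\<bar>"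
  shows "\<exists>x \<in> A. \<exists>y \<in> A. (\<forall>z \<in> A. f z \<le> f x) \<and> (card A \<ge> 2 \<longrightarrow> x \<noteq> y) \<and>
    K * (int (card A) - 1) - 2 * sum w A + w x + w y \<le> f x - f y"
  using assms
proof (induction A rule: finite_ranking_induct[where f = f])
  case empty
  then show ?case by simp
next
  case (insert x A)
  \<comment> \<open>The ranking induction may insert an element that is already present.\<close>
  consider "x \<in> A" | "A = {}" | "x \<notin> A" "A \<noteq> {}" by blast
  then show ?case
  proof cases
    case 1
    with insert have "insert x A = A" "A \<noteq> {}" by auto
    with insert show ?thesis by simp
  next
    case 2
    then show ?thesis by simp
  next
    case 3
    with insert obtain x' y where *: "x' \<in> A" "y \<in> A"
      "K * (int (card A) - 1) - 2 * sum w A + w x' + w y \<le> f x' - f y"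
      by (metis insertI2)
    have "K - w x - w x' \<le> \<bar>f x - f x'\<bar>"
      using insert.prems(2)[of x x'] * 3 by auto
    moreover have "f x' \<le> f x" using insert.hyps * by blast
    ultimately have "K - w x - w x' \<le> f x - f x'" by simp
    then have "K * (int (card (insert x A)) - 1) - 2 * sum w (insert x A) + w x + w y \<le> f x - f y"
      using * 3 insert.hyps(1) by (simp add: algebra_simps)
    moreover have "x \<noteq> y" using * 3 by auto
    ultimately show ?thesis using insert.hyps * by (intro bexI[of _ x] bexI[of _ y]) auto
  qed
qed

lemma label_span_star_product_ge:
  assumes "m \<ge> 2" "n \<ge> 2" and f: "radio_labeling (star m \<box> star n) f"
  shows "m * n + 3 * (m + n) + 1 \<le> label_span (star m \<box> star n) f"
proof -
  let ?V = "{0..m} \<times> {0..n}"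
  let ?s = "\<lambda>a::nat. if a = 0 then 0 else 1 :: int"
  let ?w = "\<lambda>u. ?s (fst u) + ?s (snd u)"
  have gap: "5 - ?w u - ?w v \<le> \<bar>int (f u) - int (f v)\<bar>" if "u \<in> ?V" "v \<in> ?V" "u \<noteq> v" for u v
  proof -
    obtain a b a' b' where uv: "u = (a, b)" "v = (a', b')" by force
    have "5 - int (star_dist a a' + star_dist b b') \<le> \<bar>int (f u) - int (f v)\<bar>"
      using f that unfolding radio_labeling_star_product_iff[OF assms(1,2)] uv by auto
    moreover have "int (star_dist x y) \<le> ?s x + ?s y" for x y
      by (simp add: star_dist_def)
    from this[of a a'] this[of b b']
    have "int (star_dist a a' + star_dist b b') \<le> ?w u + ?w v"
      unfolding uv fst_conv snd_conv of_nat_add by linarith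
    ultimately show ?thesis by linarith
  qed
  have card: "card ?V = (m + 1) * (n + 1)" by simp
  then have "card ?V \<ge> 2" using assms by simp
  then obtain x y where xy: "x \<in> ?V" "y \<in> ?V" "x \<noteq> y"
    "5 * (int (card ?V) - 1) - 2 * sum ?w ?V + ?w x + ?w y \<le> int (f x) - int (f y)"
    using weighted_gap_bound[of ?V 5 ?w "\<lambda>u. int (f u)"] gap by auto
  have s: "sum ?s {0..k} = int k" for k by (induction k) auto
  have "sum ?w ?V = (\<Sum>a\<in>{0..m}. \<Sum>b\<in>{0..n}. ?s a + ?s b)"
    by (simp only: sum.cartesian_product) (simp add: case_prod_beta)
  also have "\<dots> = (n + 1) * sum ?s {0..m} + (m + 1) * sum ?s {0..n}"
    by (simp only: sum.distrib sum_constant card_atLeastAtMost sum_distrib_left[symmetric]) simp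
  also have "\<dots> = (n + 1) * m + (m + 1) * n" by (simp only: s of_nat_add of_nat_mult)
  finally have sum: "sum ?w ?V = (n + 1) * m + (m + 1) * n" .
  \<comment> \<open>Only the centre has weight 0, so two distinct ends have total weight at least 1.
    This is the final 1 of the bound; the rest is 5((m+1)(n+1) - 1) - 2((n+1)m + (m+1)n) = mn +
    3(m+n).\<close>
  have "?w x + ?w y \<ge> 1" using xy(3) by (auto simp: prod_eq_iff)
  with xy(4) have "int (m * n + 3 * (m + n) + 1) \<le> int (f x) - int (f y)"
    unfolding sum card by (simp add: algebra_simps)
  moreover have "f x \<le> Max (f ` ?V)" "Min (f ` ?V) \<le> f y" using xy by auto
  ultimately show ?thesis unfolding label_span_def pverts_star_product by linarith
qed

section \<open>A labeling attaining the bound\<close>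

text \<open>Vertex \<open>(a, b)\<close> with \<open>a, b \<ge> 1\<close> lies on diagonal
  \<open>(a - b) mod m\<close>; the summand \<open>m\<close> avoids truncated subtraction.\<close>

definition diagonal_labeling :: "nat \<Rightarrow> nat \<Rightarrow> nat \<times> nat \<Rightarrow> nat" where
  "diagonal_labeling m n = (\<lambda>(a, b).
     if a = 0 then (if b = 0 then 0 else m * (n + 3) + 3 * b + 1)
     else if b = 0 then (a - 1) * (n + 3) + n + 4
     else ((a + m - b) mod m) * (n + 3) + b + 2)"

text \<open>Trades the congruence for two linear equations, since a diagonal wraps around at most
  once.\<close>

lemma diagonal_mod_cases:
  fixes a b m :: nat
  assumes "1 \<le> a" "a \<le> m" "1 \<le> b" "b \<le> m"
  shows "a = (a + m - b) mod m + b \<or> a + m = (a + m - b) mod m + b"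
proof (cases "a < b")
  case True
  then show ?thesis using assms by simp
next
  case False
  then have "a + m - b = (a - b) + m" "a - b < m" using assms by auto
  then have "(a + m - b) mod m = a - b" by (simp only: mod_add_self2 mod_less)
  with False show ?thesis by simp
qed

lemma block_gap:
  fixes s s' k :: nat
  assumes "s < s'"
  shows "s * k + k \<le> s' * k"
proof -
  have "Suc s * k \<le> s' * k" using assms by (intro mult_le_mono1) simp
  then show ?thesis by simp
qed

text \<open>Block s starts at s(n+3): diagonal s takes offsets 3 to n+2, row vertex
  \<open>(s + 1, 0)\<close> offset n+4, and the next diagonal begins at offset n+6. The column
  vertices follow from m(n+3)+4 in steps of 3. The condition is checked for each pair of vertex
  kinds.\<close>

lemma radio_labeling_diagonal:
  assumes "n \<ge> 3" "m \<ge> n"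
  shows "radio_labeling (star m \<box> star n) (diagonal_labeling m n)"
proof -
  let ?f = "diagonal_labeling m n"
  let ?ok = "\<lambda>a b a' b'. 5 - int (star_dist a a' + star_dist b b') \<le>
    \<bar>int (?f (a, b)) - int (?f (a', b'))\<bar>"
  have sym: "?ok a b a' b'" if "?ok a' b' a b" for a b a' b'
  proof -
    have "star_dist x y = star_dist y x" for x y by (auto simp: star_dist_def)
    then show ?thesis using that by (metis abs_minus_commute)
  qed
  have center: "?ok 0 0 a b" if "a \<le> m" "b \<le> n" "(a, b) \<noteq> (0, 0)" for a b
  proof -
    \<comment> \<open>Vertices adjacent to the centre need label at least 4, leaf pairs only
      3.\<close>
    have "4 \<le> ?f (a, b) \<or> 1 \<le> a \<and> 1 \<le> b \<and> 3 \<le> ?f (a, b)"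
      using that assms by (auto simp: diagonal_labeling_def)
    moreover have "?f (0, 0) = 0" by (simp add: diagonal_labeling_def)
    ultimately show ?thesis using that(3) by (auto simp: star_dist_def)
  qed
  have col_col: "?ok 0 b 0 b'" if "b \<ge> 1" "b' \<ge> 1" "b \<noteq> b'" for b b'
    using that by (auto simp: diagonal_labeling_def star_dist_def)
  have row_col: "?ok a 0 0 b" if "1 \<le> a" "a \<le> m" "1 \<le> b" for a b
  proof -
    have "a - 1 < m" using that by simp
    from block_gap[OF this, of "n + 3"] have "?f (a, 0) + 3 \<le> ?f (0, b)"
      using that by (simp add: diagonal_labeling_def)
    then show ?thesis using that by (simp add: star_dist_def)
  qed
  have row_less: "?ok a 0 a' 0" if "1 \<le> a" "a < a'" for a a'
  proof -
    have "a - 1 < a' - 1" using that by simp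
    from block_gap[OF this, of "n + 3"] have "?f (a, 0) + 3 \<le> ?f (a', 0)"
      using that by (simp add: diagonal_labeling_def)
    then show ?thesis using that by (simp add: star_dist_def)
  qed
  have row_row: "?ok a 0 a' 0" if "1 \<le> a" "1 \<le> a'" "a \<noteq> a'" for a a'
    using that row_less[of a a'] sym[OF row_less[of a' a]] by (cases "a < a'") simp_all
  have leaf_col: "?ok a b 0 b'" if "1 \<le> a" "a \<le> m" "1 \<le> b" "b \<le> n" "1 \<le> b'" for a b b'
  proof -
    define s where "s = (a + m - b) mod m"
    have s: "(a + m - b) mod m = s" "s < m"
      using that assms by (simp_all add: s_def)
    then have "?f (a, b) = s * (n + 3) + b + 2" using that by (simp add: diagonal_labeling_def)
    moreover have "?f (0, b') = m * (n + 3) + 3 * b' + 1"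
      using that by (simp add: diagonal_labeling_def)
    ultimately show ?thesis using block_gap[OF s(2), of "n + 3"] that by linarith
  qed
  have leaf_row: "?ok a b a' 0"
    if "1 \<le> a" "a \<le> m" "1 \<le> b" "b \<le> n" "1 \<le> a'" "a' \<le> m" for a b a'
  proof -
    define s where "s = (a + m - b) mod m"
    have s: "(a + m - b) mod m = s" "s < m" "a = s + b \<or> a + m = s + b"
      using diagonal_mod_cases[of a m b] that assms by (simp_all add: s_def)
    define s' where "s' = a' - 1"
    have f: "?f (a, b) = s * (n + 3) + b + 2" using that s by (simp add: diagonal_labeling_def)
    have f': "?f (a', 0) = s' * (n + 3) + n + 4"
      using that by (simp add: diagonal_labeling_def s'_def)
    have d: "star_dist a a' + star_dist b 0 = (if a = a' then 1 else 3)"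
      using that by (simp add: star_dist_def)
    show ?thesis
    proof (cases s s' rule: linorder_cases)
      case less
      then have "?f (a, b) + 4 \<le> ?f (a', 0)"
        using block_gap[OF less, of "n + 3"] that unfolding f f' by simp
      then show ?thesis unfolding d by auto
    next
      case equal
      \<comment> \<open>The row vertex after diagonal s meets its row only in the first entry, which
        lies n + 1 labels back; n + 1 is at least 4 because \<open>n \<ge> 3\<close>.\<close>
      then have "a = a' \<Longrightarrow> b = 1" using s that assms s'_def by auto
      then show ?thesis using equal that assms unfolding f f' d by auto
    next
      case greater
      show ?thesis
      proof (cases "s = Suc s'")
        case True
        \<comment> \<open>Against the following diagonal the gap is b + 1. A shared row forces b =
          m, hence a gap of m + 1, again at least 4.\<close>
        then have "a = a' \<Longrightarrow> b = m" using s that assms s'_def by auto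
        then show ?thesis using True that assms unfolding f f' d by auto
      next
        case False
        then have "Suc s' < s" using greater by simp
        from block_gap[OF this, of "n + 3"] have "?f (a', 0) + 4 \<le> ?f (a, b)"
          using that unfolding f f' by simp
        then show ?thesis unfolding d by auto
      qed
    qed
  qed
  have leaf_leaf: "?ok a b a' b'"
    if "1 \<le> a" "a \<le> m" "1 \<le> b" "b \<le> n" "1 \<le> a'" "a' \<le> m" "1 \<le> b'" "b' \<le> n" "(a, b) \<noteq> (a', b')"
    for a b a' b'
  proof -
    define s where "s = (a + m - b) mod m"
    have s: "(a + m - b) mod m = s" "s < m" "a = s + b \<or> a + m = s + b"
      using diagonal_mod_cases[of a m b] that assms by (simp_all add: s_def)
    define s' where "s' = (a' + m - b') mod m"
    have s': "(a' + m - b') mod m = s'" "s' < m" "a' = s' + b' \<or> a' + m = s' + b'"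
      using diagonal_mod_cases[of a' m b'] that assms by (simp_all add: s'_def)
    have f: "?f (a, b) = s * (n + 3) + b + 2" using that s by (simp add: diagonal_labeling_def)
    have f': "?f (a', b') = s' * (n + 3) + b' + 2"
      using that s' by (simp add: diagonal_labeling_def)
    have d: "star_dist a a' + star_dist b b' \<ge> 1"
      using that by (auto simp: star_dist_def)
    show ?thesis
    proof (cases s s' rule: linorder_cases)
      case less
      \<comment> \<open>The gap 4 is attained between the last entry of a diagonal and the first
        entry of the next one.\<close>
      then have "?f (a, b) + 4 \<le> ?f (a', b')"
        using block_gap[OF less, of "n + 3"] that unfolding f f' by simp
      then show ?thesis using d by linarith
    next
      case equal
      \<comment> \<open>Since \<open>m \<ge> n\<close>, a diagonal meets each row and each column at
        most once; its entries are thus at mutual distance 4 and may take consecutive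
        labels.\<close>
      then have "a \<noteq> a'" "b \<noteq> b'" using s s' that assms by auto
      then show ?thesis using equal that unfolding f f' by (auto simp: star_dist_def)
    next
      case greater
      then have "?f (a', b') + 4 \<le> ?f (a, b)"
        using block_gap[OF greater, of "n + 3"] that unfolding f f' by simp
      then show ?thesis using d by linarith
    qed
  qed
  have "?ok a b a' b'" if "a \<le> m" "b \<le> n" "a' \<le> m" "b' \<le> n" "(a, b) \<noteq> (a', b')" for a b a' b'
  proof -
    have z: "x = 0 \<or> 1 \<le> x" for x :: nat by auto
    show ?thesis
      \<comment> \<open>Sixteen patterns of zero coordinates, each settled by one of the facts above
        or its mirror image.\<close>
      using z[of a] z[of b] z[of a'] z[of b'] that
      by (elim disjE; hypsubst?)
        (blast intro: center col_col row_col row_row leaf_col leaf_row leaf_leaf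
          sym[OF center] sym[OF row_col] sym[OF leaf_col] sym[OF leaf_row])+
  qed
  then show ?thesis
    using assms by (subst radio_labeling_star_product_iff) auto
qed

text \<open>The bound is the label of \<open>(0, n)\<close>, the last vertex visited.\<close>

lemma diagonal_labeling_le:
  assumes "n \<ge> 1" "m \<ge> n" "a \<le> m" "b \<le> n"
  shows "diagonal_labeling m n (a, b) \<le> m * n + 3 * (m + n) + 1"
proof -
  consider "a = 0" | "a \<ge> 1" "b = 0" | "a \<ge> 1" "b \<ge> 1" by linarith
  then show ?thesis
  proof cases
    case 1
    then show ?thesis using assms by (simp add: diagonal_labeling_def algebra_simps)
  next
    case 2
    then have "a - 1 < m" using assms by simp
    from block_gap[OF this, of "n + 3"]
    have "diagonal_labeling m n (a, b) + 3 \<le> m * (n + 3) + n + 4"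
      using 2 by (simp add: diagonal_labeling_def)
    then show ?thesis by (simp add: algebra_simps)
  next
    case 3
    then have "(a + m - b) mod m < m" using assms by simp
    from block_gap[OF this, of "n + 3"] show ?thesis
      using 3 assms by (simp add: diagonal_labeling_def algebra_simps)
  qed
qed

lemma label_span_diagonal_le:
  assumes "n \<ge> 1" "m \<ge> n"
  shows "label_span (star m \<box> star n) (diagonal_labeling m n) \<le> m * n + 3 * (m + n) + 1"
proof -
  have "Max (diagonal_labeling m n ` ({0..m} \<times> {0..n})) \<le> m * n + 3 * (m + n) + 1"
    using diagonal_labeling_le[OF assms] by (intro Max.boundedI) auto
  then show ?thesis unfolding label_span_def pverts_star_product by linarith
qed

theorem theorem4p1:
  fixes m n :: nat
  assumes "n \<ge> 3" and "m \<ge> n"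
  shows "radio_number (star m \<box> star n) = m * n + 3 * (m + n) + 1"
  unfolding radio_number_def
proof (rule Least_equality)
  \<comment> \<open>The span is only bounded above directly; the lower bound for arbitrary radio
    labelings forces equality.\<close>
  have "label_span (star m \<box> star n) (diagonal_labeling m n) = m * n + 3 * (m + n) + 1"
    using assms by (intro antisym label_span_diagonal_le label_span_star_product_ge
      radio_labeling_diagonal) auto
  then show "\<exists>f. radio_labeling (star m \<box> star n) f \<and>
      label_span (star m \<box> star n) f = m * n + 3 * (m + n) + 1"
    using radio_labeling_diagonal[OF assms] by blast
next
  fix k
  assume "\<exists>f. radio_labeling (star m \<box> star n) f \<and> label_span (star m \<box> star n) f = k"
  then show "m * n + 3 * (m + n) + 1 \<le> k"
    using label_span_star_product_ge assms by fastforce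
qed

end
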